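(* Let $(\gamma, \bm n_1, \bm n_2) : I \to \mathbb H^p \times \Delta$ be a non-parabolic spatial hybrid framed curve with curvature $(L, M, 0, \alpha)$, where $M(t)>0$ and $L(t) \neq 0$ for all $t \in I$. Let $\bm\mu=\bm n_1\times\bm n_2$ and let $\mathcal Inv_\gamma$ be an involute of $(\gamma,\bm n_1,\bm n_2)$. Then the evolute of the non-parabolic spatial hybrid framed curve $(\mathcal Inv_\gamma, \bm n_1, \bm\mu)$ is $\gamma$.
   Context: All maps are $C^\infty$; $I\subseteq\mathbb R$ is an interval. $\mathbb H^p = \{b\bm i + c\bm\varepsilon + d\bm h : b,c,d\in\mathbb R\}$ is the 3-dimensional real vector space with basis $\{\bm i,\bm\varepsilon,\bm h\}$. For $\bm H_k = b_k \bm i + c_k \bm\varepsilon + d_k \bm h$, the scalar product is $g(\bm H_1,\bm H_2) = b_1b_2 - b_1c_2 - b_2c_1 - d_1d_2$; the norm is $\|\bm H\| = \sqrt{|g(\bm H,\bm H)|}$; the vector product is $$\bm H_1 \times \bm H_2 = (b_2d_1 - b_1d_2)\bm i + (b_2d_1 - b_1d_2 - c_2d_1 + c_1d_2)\bm\varepsilon + (b_1c_2 - b_2c_1)\bm h.$$ Let $\Delta = \{(\bm\nu_1, \bm\nu_2) \in \mathbb H^p \times \mathbb H^p : \|\bm\nu_1\| = \|\bm\nu_2\| = 1,\ g(\bm\nu_1, \bm\nu_2) = 0\}$. Non-parabolic spatial hybrid framed curve: a smooth map $(\gamma, \bm\nu_1, \bm\nu_2) : I \to \mathbb H^p \times \Delta$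 with $g(\gamma'(t), \bm\nu_1(t)) = g(\gamma'(t), \bm\nu_2(t)) = 0$ for all $t \in I$. Put $\bm\mu = \bm\nu_1\times\bm\nu_2$ and $s_1 = g(\bm\nu_1,\bm\nu_1)$, $s_2 = g(\bm\nu_2,\bm\nu_2)$ (constants in $\{1,-1\}$). Its curvature is $(l,m,n,\alpha): I\to\mathbb R^4$, where $$l = s_2 g(\bm\nu_1',\bm\nu_2),\quad m = s_1s_2 g(\bm\nu_1',\bm\mu),\quad n = s_1s_2 g(\bm\nu_2',\bm\mu),\quad \alpha = s_1s_2 g(\gamma',\bm\mu);$$ equivalently $\gamma' = \alpha\bm\mu$, $\bm\nu_1' = l\bm\nu_2 + m\bm\mu$, $\bm\nu_2' = -s_1s_2 l\bm\nu_1 + n\bm\mu$, $\bm\mu' = -s_2 m\bm\nu_1 - s_1 n\bm\nu_2$. Evolute: for a non-parabolic spatial hybrid framed curve $(\gamma,\bm\nu_1,\bm\nu_2)$ with curvature $(l,m,n,\alpha)$ such that $D(t) := m(t)n'(t) - m'(t)n(t) + s_1s_2 l(t)m^2(t) + l(t)n^2(t)\neq 0$ for all $t\in I$, its evolute is the map $\mathcal Ev_\gamma: I\to\mathbb H^p$, $$\mathcal Ev_\gamma = \gamma - \frac{n'\alpha - n\alpha' + s_1s_2\, l m\alpha}{D}\,\bm\nu_1 - \frac{m\alpha' - m'\alpha + l n\alpha}{D}\,\bm\nu_2 .$$ Involute: for a non-parabolic spatial hybrid framed curve $(\gamma,\bm n_1,\bm n_2)$ with curvature $(L,M,0,\alpha)$,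 put $\sigma = g(\bm n_1,\bm n_1)$ and $\bm\mu = \bm n_1\times\bm n_2$ (so $\sigma\, g(\bm n_2,\bm n_2) = g(\bm\mu,\bm\mu)$). An involute is a map $\mathcal Inv_\gamma: I\to\mathbb H^p$, $$\mathcal Inv_\gamma(t) = \gamma(t) + f_1(t)\bm n_1(t) + f_2(t)\bm\mu(t),$$ where $(f_1,f_2)$ is a solution on $I$ of $f_1' = \sigma\, g(\bm\mu,\bm\mu)\, M f_2$, $f_2' = -M f_1 - \alpha$. The triple $(\mathcal Inv_\gamma,\bm n_1,\bm\mu)$ is a non-parabolic spatial hybrid framed curve. *)

theory Defs
  imports "HOL-Analysis.Analysis"
begin

text \<open>Derivatives are taken within the parameter interval \<open>I\<close>, so that they are one-sided at
  the endpoints belonging to \<open>I\<close>. They are meaningful when \<open>I\<close> is an interval with nonempty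
  interior.\<close>

definition deriv_on :: "real set \<Rightarrow> (real \<Rightarrow> 'a::real_normed_vector) \<Rightarrow> real \<Rightarrow> 'a" where
  "deriv_on I f t = vector_derivative f (at t within I)"

definition smooth_on :: "real set \<Rightarrow> (real \<Rightarrow> 'a::real_normed_vector) \<Rightarrow> bool" where
  "smooth_on I f \<longleftrightarrow> (\<forall>k. (deriv_on I ^^ k) f differentiable_on I)"

text \<open>The element \<open>b i + c \<epsilon> + d h\<close> of \<open>H\<^sup>p\<close> is represented by its coordinates
  \<open>(b, c, d)\<close>. The Euclidean norm of the library on this type serves only to define derivatives;
  the metric notions below use the indefinite scalar product.\<close>

type_synonym hybrid = "real ^ 3"

definition hinner :: "hybrid \<Rightarrow> hybrid \<Rightarrow> real" where
  "hinner H1 H2 = H1$1 * H2$1 - H1$1 * H2$2 - H2$1 * H1$2 - H1$3 * H2$3"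

definition hnorm :: "hybrid \<Rightarrow> real" where
  "hnorm H = sqrt \<bar>hinner H H\<bar>"

definition hcross :: "hybrid \<Rightarrow> hybrid \<Rightarrow> hybrid" where
  "hcross H1 H2 = vector
     [H2$1 * H1$3 - H1$1 * H2$3,
      H2$1 * H1$3 - H1$1 * H2$3 - H2$2 * H1$3 + H1$2 * H2$3,
      H1$1 * H2$2 - H2$1 * H1$2]"

definition Delta :: "(hybrid \<times> hybrid) set" where
  "Delta = {(v1, v2). hnorm v1 = 1 \<and> hnorm v2 = 1 \<and> hinner v1 v2 = 0}"

definition framed_curve ::
    "real set \<Rightarrow> (real \<Rightarrow> hybrid) \<Rightarrow> (real \<Rightarrow> hybrid) \<Rightarrow> (real \<Rightarrow> hybrid) \<Rightarrow> bool" where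
  "framed_curve I \<gamma> \<nu>1 \<nu>2 \<longleftrightarrow>
     smooth_on I \<gamma> \<and> smooth_on I \<nu>1 \<and> smooth_on I \<nu>2 \<and>
     (\<forall>t\<in>I. (\<nu>1 t, \<nu>2 t) \<in> Delta \<and>
            hinner (deriv_on I \<gamma> t) (\<nu>1 t) = 0 \<and>
            hinner (deriv_on I \<gamma> t) (\<nu>2 t) = 0)"

definition frame_mu :: "(real \<Rightarrow> hybrid) \<Rightarrow> (real \<Rightarrow> hybrid) \<Rightarrow> real \<Rightarrow> hybrid" where
  "frame_mu \<nu>1 \<nu>2 t = hcross (\<nu>1 t) (\<nu>2 t)"

text \<open>The sign \<open>g(\<nu>, \<nu>)\<close>; it takes values in \<open>{1, -1}\<close> and is constant on \<open>I\<close> for the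
  vectors of a framed curve.\<close>

definition sgn_at :: "(real \<Rightarrow> hybrid) \<Rightarrow> real \<Rightarrow> real" where
  "sgn_at \<nu> t = hinner (\<nu> t) (\<nu> t)"

definition curv_l :: "real set \<Rightarrow> (real \<Rightarrow> hybrid) \<Rightarrow> (real \<Rightarrow> hybrid) \<Rightarrow> real \<Rightarrow> real" where
  "curv_l I \<nu>1 \<nu>2 t = sgn_at \<nu>2 t * hinner (deriv_on I \<nu>1 t) (\<nu>2 t)"

definition curv_m :: "real set \<Rightarrow> (real \<Rightarrow> hybrid) \<Rightarrow> (real \<Rightarrow> hybrid) \<Rightarrow> real \<Rightarrow> real" where
  "curv_m I \<nu>1 \<nu>2 t =
     sgn_at \<nu>1 t * sgn_at \<nu>2 t * hinner (deriv_on I \<nu>1 t) (frame_mu \<nu>1 \<nu>2 t)"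

definition curv_n :: "real set \<Rightarrow> (real \<Rightarrow> hybrid) \<Rightarrow> (real \<Rightarrow> hybrid) \<Rightarrow> real \<Rightarrow> real" where
  "curv_n I \<nu>1 \<nu>2 t =
     sgn_at \<nu>1 t * sgn_at \<nu>2 t * hinner (deriv_on I \<nu>2 t) (frame_mu \<nu>1 \<nu>2 t)"

definition curv_alpha ::
    "real set \<Rightarrow> (real \<Rightarrow> hybrid) \<Rightarrow> (real \<Rightarrow> hybrid) \<Rightarrow> (real \<Rightarrow> hybrid) \<Rightarrow> real \<Rightarrow> real" where
  "curv_alpha I \<gamma> \<nu>1 \<nu>2 t =
     sgn_at \<nu>1 t * sgn_at \<nu>2 t * hinner (deriv_on I \<gamma> t) (frame_mu \<nu>1 \<nu>2 t)"

definition curvature ::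
    "real set \<Rightarrow> (real \<Rightarrow> hybrid) \<Rightarrow> (real \<Rightarrow> hybrid) \<Rightarrow> (real \<Rightarrow> hybrid) \<Rightarrow> real
      \<Rightarrow> real \<times> real \<times> real \<times> real" where
  "curvature I \<gamma> \<nu>1 \<nu>2 t =
     (curv_l I \<nu>1 \<nu>2 t, curv_m I \<nu>1 \<nu>2 t, curv_n I \<nu>1 \<nu>2 t, curv_alpha I \<gamma> \<nu>1 \<nu>2 t)"

definition evolute_denom ::
    "real set \<Rightarrow> (real \<Rightarrow> hybrid) \<Rightarrow> (real \<Rightarrow> hybrid) \<Rightarrow> real \<Rightarrow> real" where
  "evolute_denom I \<nu>1 \<nu>2 t =
     (let s1 = sgn_at \<nu>1 t; s2 = sgn_at \<nu>2 t;
          l = curv_l I \<nu>1 \<nu>2; m = curv_m I \<nu>1 \<nu>2; n = curv_n I \<nu>1 \<nu>2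
      in m t * deriv_on I n t - deriv_on I m t * n t
         + s1 * s2 * l t * (m t)\<^sup>2 + l t * (n t)\<^sup>2)"

text \<open>Meaningful only where \<^const>\<open>evolute_denom\<close> does not vanish.\<close>

definition evolute ::
    "real set \<Rightarrow> (real \<Rightarrow> hybrid) \<Rightarrow> (real \<Rightarrow> hybrid) \<Rightarrow> (real \<Rightarrow> hybrid) \<Rightarrow> real \<Rightarrow> hybrid" where
  "evolute I \<gamma> \<nu>1 \<nu>2 t =
     (let s1 = sgn_at \<nu>1 t; s2 = sgn_at \<nu>2 t;
          l = curv_l I \<nu>1 \<nu>2; m = curv_m I \<nu>1 \<nu>2; n = curv_n I \<nu>1 \<nu>2;
          \<alpha> = curv_alpha I \<gamma> \<nu>1 \<nu>2; D = evolute_denom I \<nu>1 \<nu>2 t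
      in \<gamma> t
         - ((deriv_on I n t * \<alpha> t - n t * deriv_on I \<alpha> t + s1 * s2 * l t * m t * \<alpha> t) / D) *\<^sub>R \<nu>1 t
         - ((m t * deriv_on I \<alpha> t - deriv_on I m t * \<alpha> t + l t * n t * \<alpha> t) / D) *\<^sub>R \<nu>2 t)"

text \<open>\<open>\<iota>\<close> is one of the involutes (there is one for each solution of the linear system) of a
  framed curve whose third curvature component vanishes. Smoothness of \<open>f1\<close> and \<open>f2\<close> is not
  required, since it follows from the differential equations.\<close>

definition is_involute ::
    "real set \<Rightarrow> (real \<Rightarrow> hybrid) \<Rightarrow> (real \<Rightarrow> hybrid) \<Rightarrow> (real \<Rightarrow> hybrid) \<Rightarrow> (real \<Rightarrow> hybrid) \<Rightarrow> bool"
  where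
  "is_involute I \<gamma> n1 n2 \<iota> \<longleftrightarrow>
     (let \<mu> = frame_mu n1 n2; M = curv_m I n1 n2; \<alpha> = curv_alpha I \<gamma> n1 n2
      in \<exists>f1 f2 :: real \<Rightarrow> real.
           (\<forall>t\<in>I. (f1 has_real_derivative sgn_at n1 t * sgn_at \<mu> t * M t * f2 t) (at t within I)) \<and>
           (\<forall>t\<in>I. (f2 has_real_derivative - M t * f1 t - \<alpha> t) (at t within I)) \<and>
           (\<forall>t\<in>I. \<iota> t = \<gamma> t + f1 t *\<^sub>R n1 t + f2 t *\<^sub>R \<mu> t))"

end

theory Submission imports Defs begin

text \<open>
  Write \<open>s\<^sub>1, s\<^sub>2\<close> for the signs of \<open>n\<^sub>1, n\<^sub>2\<close>. The Frenet formulas with \<open>n = 0\<close> read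
  \<open>\<gamma>' = \<alpha> \<mu>\<close>, \<open>n\<^sub>1' = L n\<^sub>2 + M \<mu>\<close>, \<open>\<mu>' = - s\<^sub>2 M n\<^sub>1\<close>. Differentiating the involute
  \<open>\<iota> = \<gamma> + f\<^sub>1 n\<^sub>1 + f\<^sub>2 \<mu>\<close>, the equations for \<open>f\<^sub>1\<close> and \<open>f\<^sub>2\<close> say exactly that the components along
  \<open>n\<^sub>1\<close> and \<open>\<mu>\<close> vanish, so that \<open>\<iota>' = f\<^sub>1 L n\<^sub>2\<close>. Hence \<open>(\<iota>, n\<^sub>1, \<mu>)\<close> is a framed curve once \<open>f\<^sub>1\<close> and
  \<open>f\<^sub>2\<close> are known to be smooth, which a bootstrap gives (\<open>smooth_on_linear_system\<close>).

  The third vector of the new frame is \<open>n\<^sub>1 \<times> \<mu> = - s\<^sub>1 n\<^sub>2\<close>, so the new curvature is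
  \<open>(M, - s\<^sub>1 L, 0, - s\<^sub>1 f\<^sub>1 L)\<close> (\<open>curvature_frame_swap\<close>). Its last entry is \<open>f\<^sub>1\<close> times its second entry
  \<open>m\<close>. The denominator of the evolute is therefore \<open>s\<^sub>2 M L\<^sup>2 \<noteq> 0\<close>, and its two coefficients reduce to
  \<open>f\<^sub>1\<close> and \<open>m\<^sup>2 f\<^sub>1' / (s\<^sub>2 M L\<^sup>2) = f\<^sub>2\<close> (\<open>evolute_of_multiple\<close>): the evolute subtracts from \<open>\<iota>\<close>
  precisely what the involute added to \<open>\<gamma>\<close>.

  The Frenet formulas come from expanding a vector in the orthonormal frame (\<open>frame_expansion\<close>),
  which rests on the double product formula for the vector product, and from differentiating the
  constant scalar products of frame vectors.
\<close>

section \<open>Smooth functions on a perfect parameter set\<close>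

text \<open>The derivative within \<open>I\<close> is unique precisely at the limit points of \<open>I\<close>, so calculus with
  \<^const>\<open>deriv_on\<close> rests on this property of the interval alone.\<close>

lemma interval_islimpt:
  fixes I :: "real set"
  assumes "is_interval I" "interior I \<noteq> {}" "t \<in> I"
  shows "t islimpt I"
proof (rule connected_imp_perfect)
  show "connected I" using assms(1) by (rule is_interval_connected)
  show "\<not> I = {x}" for x using assms(2) by auto
qed (rule assms(3))

lemma deriv_on_eqI:
  assumes "t islimpt I" "(f has_vector_derivative D) (at t within I)"
  shows "deriv_on I f t = D"
  unfolding deriv_on_def using assms by (auto intro: vector_derivative_within simp: trivial_limit_within)

lemma has_vector_derivative_deriv_on:
  assumes "f differentiable_on I" "t \<in> I"
  shows "(f has_vector_derivative deriv_on I f t) (at t within I)"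
  using assms unfolding deriv_on_def differentiable_on_def
  by (simp add: vector_derivative_works)

lemma deriv_on_cong:
  assumes "\<And>t. t \<in> I \<Longrightarrow> f t = g t" "t \<in> I"
  shows "deriv_on I f t = deriv_on I g t"
proof -
  have "(f has_vector_derivative D) (at t within I) \<longleftrightarrow> (g has_vector_derivative D) (at t within I)" for D
    using assms has_vector_derivative_transform by metis
  then show ?thesis by (simp add: deriv_on_def vector_derivative_def)
qed

lemma deriv_on_const:
  assumes "t islimpt I" "t \<in> I" "\<And>t. t \<in> I \<Longrightarrow> f t = c"
  shows "deriv_on I f t = 0"
  using deriv_on_cong[of I f "\<lambda>_. c" t] deriv_on_eqI[OF assms(1) has_vector_derivative_const] assms by simp

text \<open>Smoothness is not inductive: product rules and bootstrap arguments have to assert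
  differentiability up to a given order and then raise the order. The recursion peels off the
  innermost derivative, so that a formula for \<open>f'\<close> can be used in the induction step.\<close>

primrec diff_order :: "nat \<Rightarrow> real set \<Rightarrow> (real \<Rightarrow> 'a::real_normed_vector) \<Rightarrow> bool" where
  "diff_order 0 I f = True"
| "diff_order (Suc k) I f = (f differentiable_on I \<and> diff_order k I (deriv_on I f))"

lemma diff_order_iff: "diff_order k I f \<longleftrightarrow> (\<forall>j<k. (deriv_on I ^^ j) f differentiable_on I)"
  by (induction k arbitrary: f) (auto simp: less_Suc_eq_0_disj funpow_swap1)

lemma smooth_on_iff: "smooth_on I f \<longleftrightarrow> (\<forall>k. diff_order k I f)"
  unfolding smooth_on_def diff_order_iff by blast

lemma smooth_on_SucD: "smooth_on I f \<Longrightarrow> diff_order (Suc k) I f"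
  unfolding smooth_on_iff by (rule spec)

lemma smooth_on_deriv_on: "smooth_on I f \<Longrightarrow> smooth_on I (deriv_on I f)"
  using smooth_on_SucD[of I f] by (simp add: smooth_on_iff[of I "deriv_on I f"])

lemma smooth_on_differentiable_on: "smooth_on I f \<Longrightarrow> f differentiable_on I"
  using smooth_on_SucD[of I f] by simp

lemma diff_order_mono: "diff_order (Suc k) I f \<Longrightarrow> diff_order k I f"
  by (simp add: diff_order_iff)

lemma diff_order_cong:
  assumes "\<And>t. t \<in> I \<Longrightarrow> f t = g t"
  shows "diff_order k I f \<longleftrightarrow> diff_order k I g"
  using assms
proof (induction k arbitrary: f g)
  case (Suc k)
  have "f differentiable_on I \<longleftrightarrow> g differentiable_on I"
    using Suc.prems differentiable_transform_within[of f _ I 1 g]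
      differentiable_transform_within[of g _ I 1 f]
    unfolding differentiable_on_def by auto
  moreover have "diff_order k I (deriv_on I f) \<longleftrightarrow> diff_order k I (deriv_on I g)"
    using Suc.prems by (intro Suc.IH deriv_on_cong)
  ultimately show ?case by simp
qed simp

lemma smooth_on_cong:
  assumes "\<And>t. t \<in> I \<Longrightarrow> f t = g t"
  shows "smooth_on I f \<longleftrightarrow> smooth_on I g"
  using diff_order_cong[of I f g, OF assms] by (simp add: smooth_on_iff)

lemma diff_order_SucI:
  assumes "\<forall>t\<in>I. t islimpt I"
    and "\<And>t. t \<in> I \<Longrightarrow> (f has_vector_derivative f' t) (at t within I)"
    and "diff_order k I f'"
  shows "diff_order (Suc k) I f"
proof -
  have "deriv_on I f t = f' t" if "t \<in> I" for t
    using assms(1,2) that by (auto intro: deriv_on_eqI)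
  then have "diff_order k I (deriv_on I f)"
    using diff_order_cong[of I "deriv_on I f" f'] assms(3) by blast
  moreover have "f differentiable_on I"
    using assms(2) unfolding differentiable_on_def by (blast intro: differentiableI_vector)
  ultimately show ?thesis by simp
qed

lemma smooth_on_const:
  assumes "\<forall>t\<in>I. t islimpt I"
  shows "smooth_on I (\<lambda>_. c)"
proof -
  have "diff_order k I (\<lambda>_. c)" for k
  proof (induction k arbitrary: c)
    case (Suc k)
    show ?case
      by (rule diff_order_SucI[OF assms has_vector_derivative_const Suc.IH])
  qed simp
  then show ?thesis by (simp add: smooth_on_iff)
qed

lemma diff_order_has_vector_derivative:
  assumes "diff_order (Suc k) I f" "t \<in> I"
  shows "(f has_vector_derivative deriv_on I f t) (at t within I)"
  using assms by (auto intro: has_vector_derivative_deriv_on)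

lemma diff_order_add:
  assumes "\<forall>t\<in>I. t islimpt I" "diff_order k I f" "diff_order k I g"
  shows "diff_order k I (\<lambda>t. f t + g t)"
  using assms(2,3)
proof (induction k arbitrary: f g)
  case (Suc k)
  show ?case
  proof (rule diff_order_SucI[OF assms(1)])
    show "((\<lambda>t. f t + g t) has_vector_derivative deriv_on I f t + deriv_on I g t) (at t within I)"
      if "t \<in> I" for t
      using Suc.prems that by (intro has_vector_derivative_add diff_order_has_vector_derivative)
    show "diff_order k I (\<lambda>t. deriv_on I f t + deriv_on I g t)"
      using Suc.prems by (intro Suc.IH) simp_all
  qed
qed simp

text \<open>One induction covers every product in use here: multiplication of reals, scaling of
  vectors, and the scalar and vector products of hybrid numbers.\<close>

lemma (in bounded_bilinear) diff_order_bilinear: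
  assumes "\<forall>t\<in>I. t islimpt I" "diff_order k I f" "diff_order k I g"
  shows "diff_order k I (\<lambda>t. prod (f t) (g t))"
  using assms(2,3)
proof (induction k arbitrary: f g)
  case (Suc k)
  show ?case
  proof (rule diff_order_SucI[OF assms(1)])
    show "((\<lambda>t. prod (f t) (g t)) has_vector_derivative
            prod (f t) (deriv_on I g t) + prod (deriv_on I f t) (g t)) (at t within I)"
      if "t \<in> I" for t
      using Suc.prems that by (intro has_vector_derivative diff_order_has_vector_derivative)
    show "diff_order k I (\<lambda>t. prod (f t) (deriv_on I g t) + prod (deriv_on I f t) (g t))"
      using Suc.prems diff_order_mono[OF Suc.prems(1)] diff_order_mono[OF Suc.prems(2)]
      by (intro diff_order_add[OF assms(1)] Suc.IH) simp_all
  qed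
qed simp

lemma smooth_on_add:
  assumes "\<forall>t\<in>I. t islimpt I" "smooth_on I f" "smooth_on I g"
  shows "smooth_on I (\<lambda>t. f t + g t)"
  using assms by (simp add: smooth_on_iff diff_order_add)

lemma (in bounded_bilinear) smooth_on_bilinear:
  assumes "\<forall>t\<in>I. t islimpt I" "smooth_on I f" "smooth_on I g"
  shows "smooth_on I (\<lambda>t. prod (f t) (g t))"
  using assms by (simp add: smooth_on_iff diff_order_bilinear)

text \<open>Bootstrapping: if the solution of a linear system is differentiable to some order,
  then so are the right-hand sides, hence the solution is so to the next order.\<close>

lemma smooth_on_linear_system:
  fixes x y :: "real \<Rightarrow> real"
  assumes perf: "\<forall>t\<in>I. t islimpt I"
    and x: "\<And>t. t \<in> I \<Longrightarrow> (x has_real_derivative a t * y t) (at t within I)"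
    and y: "\<And>t. t \<in> I \<Longrightarrow> (y has_real_derivative b t * x t + c t) (at t within I)"
    and sm: "smooth_on I a" "smooth_on I b" "smooth_on I c"
  shows "smooth_on I x" and "smooth_on I y"
proof -
  note diff_order_mult = bounded_bilinear.diff_order_bilinear[OF bounded_bilinear_mult]
  have "diff_order k I x \<and> diff_order k I y" for k
  proof (induction k)
    case (Suc k)
    have "diff_order (Suc k) I x"
      using x Suc sm perf
      by (intro diff_order_SucI[OF perf, where f' = "\<lambda>t. a t * y t"] diff_order_mult)
         (auto simp: has_real_derivative_iff_has_vector_derivative smooth_on_iff)
    moreover have "diff_order (Suc k) I y"
      using y Suc sm perf
      by (intro diff_order_SucI[OF perf, where f' = "\<lambda>t. b t * x t + c t"] diff_order_mult diff_order_add)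
         (auto simp: has_real_derivative_iff_has_vector_derivative smooth_on_iff)
    ultimately show ?case by simp
  qed simp
  then show "smooth_on I x" "smooth_on I y" unfolding smooth_on_iff by auto
qed

section \<open>Algebra of the scalar and vector products\<close>

lemma hcross_nth:
  "hcross A B $ 1 = B$1 * A$3 - A$1 * B$3"
  "hcross A B $ 2 = B$1 * A$3 - A$1 * B$3 - B$2 * A$3 + A$2 * B$3"
  "hcross A B $ 3 = A$1 * B$2 - B$1 * A$2"
  by (simp_all add: hcross_def)

lemma bounded_bilinear_hinner: "bounded_bilinear hinner"
  unfolding bilinear_conv_bounded_bilinear[symmetric] bilinear_def
  by (auto intro!: linearI simp: hinner_def algebra_simps)

lemma bounded_bilinear_hcross: "bounded_bilinear hcross"
  unfolding bilinear_conv_bounded_bilinear[symmetric] bilinear_def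
  by (auto intro!: linearI simp: vec_eq_iff forall_3 hcross_nth algebra_simps)

interpretation hinner: bounded_bilinear hinner by (rule bounded_bilinear_hinner)
interpretation hcross: bounded_bilinear hcross by (rule bounded_bilinear_hcross)

lemma hinner_commute: "hinner A B = hinner B A"
  by (simp add: hinner_def)

lemma hcross_anticommute: "hcross A B = - hcross B A"
  by (simp add: vec_eq_iff forall_3 hcross_nth algebra_simps)

lemma hinner_hcross_left [simp]: "hinner (hcross A B) A = 0" "hinner A (hcross A B) = 0"
  and hinner_hcross_right [simp]: "hinner (hcross A B) B = 0" "hinner B (hcross A B) = 0"
  by (simp_all add: hinner_def hcross_nth algebra_simps)

text \<open>The Euclidean double product formula carries over to the indefinite scalar product
  with the same signs, because the determinant of \<open>g\<close> in the basis \<open>i, \<epsilon>, h\<close> is \<open>1\<close>.\<close>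

lemma hcross_hcross: "hcross A (hcross B C) = hinner A C *\<^sub>R B - hinner A B *\<^sub>R C"
  by (simp add: vec_eq_iff forall_3 hcross_nth hinner_def algebra_simps)

lemma hinner_hcross_hcross:
  "hinner (hcross A B) (hcross C D) = hinner A C * hinner B D - hinner A D * hinner B C"
  by (simp add: hcross_nth hinner_def algebra_simps)

lemma Delta_sgn:
  assumes "(u, v) \<in> Delta"
  shows "hinner u u * hinner u u = 1" "hinner v v * hinner v v = 1" "hinner u v = 0"
proof -
  have *: "x * x = 1" if "sqrt \<bar>x\<bar> = 1" for x :: real
    using that by (metis abs_mult_self_eq mult_1 real_sqrt_eq_1_iff)
  show "hinner u u * hinner u u = 1" "hinner v v * hinner v v = 1" "hinner u v = 0"
    using assms * unfolding Delta_def hnorm_def by auto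
qed

lemma hinner_hcross_self:
  assumes "(u, v) \<in> Delta"
  shows "hinner (hcross u v) (hcross u v) = hinner u u * hinner v v"
  using Delta_sgn[OF assms] by (simp add: hinner_hcross_hcross)

lemma hcross_hcross_self:
  assumes "(u, v) \<in> Delta"
  shows "hcross u (hcross u v) = - hinner u u *\<^sub>R v"
  using Delta_sgn[OF assms] by (simp add: hcross_hcross)

lemma Delta_hcross:
  assumes "(u, v) \<in> Delta"
  shows "(u, hcross u v) \<in> Delta"
  using assms hinner_hcross_self[OF assms] unfolding Delta_def hnorm_def
  by (simp add: abs_mult)

text \<open>Apply the double product formula to \<open>\<mu> \<times> (H \<times> \<mu>)\<close> with \<open>\<mu> = u \<times> v\<close>: directly it gives
  \<open>g(\<mu>,\<mu>) H - g(\<mu>,H) \<mu>\<close>; expanding \<open>H \<times> \<mu>\<close> first gives a combination of \<open>u\<close> and \<open>v\<close>. Comparing the two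
  and dividing by \<open>g(\<mu>,\<mu>) = s1 s2\<close> yields \<open>H\<close>.\<close>

lemma frame_expansion:
  assumes "(u, v) \<in> Delta"
  defines "s1 \<equiv> hinner u u" and "s2 \<equiv> hinner v v" and "\<mu> \<equiv> hcross u v"
  shows "H = (s1 * hinner H u) *\<^sub>R u + (s2 * hinner H v) *\<^sub>R v + (s1 * s2 * hinner H \<mu>) *\<^sub>R \<mu>"
proof -
  have s: "s1 * s1 = 1" "s2 * s2 = 1" and uv: "hinner u v = 0" "hinner v u = 0"
    using Delta_sgn[OF assms(1)] hinner_commute[of v u] by (auto simp: s1_def s2_def)
  have mm: "hinner \<mu> \<mu> = s1 * s2"
    unfolding \<mu>_def s1_def s2_def by (rule hinner_hcross_self[OF assms(1)])
  have 1: "hcross \<mu> u = s1 *\<^sub>R v" "hcross \<mu> v = - s2 *\<^sub>R u"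
    using hcross_hcross[of u u v] hcross_hcross[of v u v] hcross_anticommute[of "hcross u v"] uv
    by (simp_all add: \<mu>_def s1_def s2_def)
  have "(s1 * s2) *\<^sub>R H - hinner \<mu> H *\<^sub>R \<mu> = hcross \<mu> (hcross H \<mu>)"
    using hcross_hcross[of \<mu> H \<mu>] mm by simp
  also have "hcross H \<mu> = hinner H v *\<^sub>R u - hinner H u *\<^sub>R v"
    unfolding \<mu>_def by (rule hcross_hcross)
  also have "hcross \<mu> \<dots> = (s1 * hinner H v) *\<^sub>R v + (s2 * hinner H u) *\<^sub>R u"
    by (simp add: hcross.diff_right hcross.scaleR_right 1 mult.commute)
  finally have "(s1 * s2) *\<^sub>R H =
      (s2 * hinner H u) *\<^sub>R u + (s1 * hinner H v) *\<^sub>R v + hinner H \<mu> *\<^sub>R \<mu>"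
    by (simp add: algebra_simps hinner_commute)
  then have "(s1 * s2) *\<^sub>R ((s1 * s2) *\<^sub>R H) =
      (s1 * s2) *\<^sub>R ((s2 * hinner H u) *\<^sub>R u + (s1 * hinner H v) *\<^sub>R v + hinner H \<mu> *\<^sub>R \<mu>)"
    by simp
  moreover have "s1 * s2 * (s1 * s2) = 1" "s1 * s2 * (s2 * x) = s1 * x" "s1 * s2 * (s1 * x) = s2 * x" for x
    using s by algebra+
  ultimately show ?thesis by (simp add: scaleR_add_right)
qed

section \<open>The frame of a framed curve\<close>

lemma framed_curve_Delta: "framed_curve I \<gamma> \<nu>1 \<nu>2 \<Longrightarrow> t \<in> I \<Longrightarrow> (\<nu>1 t, \<nu>2 t) \<in> Delta"
  by (simp add: framed_curve_def)

lemma smooth_on_frame_mu: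
  assumes "\<forall>t\<in>I. t islimpt I" "smooth_on I \<nu>1" "smooth_on I \<nu>2"
  shows "smooth_on I (frame_mu \<nu>1 \<nu>2)"
  unfolding frame_mu_def[abs_def] by (rule hcross.smooth_on_bilinear[OF assms])

lemma deriv_on_hinner:
  assumes "t islimpt I" "t \<in> I" "smooth_on I f" "smooth_on I g"
  shows "deriv_on I (\<lambda>t. hinner (f t) (g t)) t
         = hinner (f t) (deriv_on I g t) + hinner (deriv_on I f t) (g t)"
  using assms
  by (intro deriv_on_eqI hinner.has_vector_derivative has_vector_derivative_deriv_on
      smooth_on_differentiable_on)

lemma hinner_const_deriv_on:
  assumes "t islimpt I" "t \<in> I" "smooth_on I f" "smooth_on I g"
    and "\<And>t. t \<in> I \<Longrightarrow> hinner (f t) (g t) = c"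
  shows "hinner (deriv_on I f t) (g t) = - hinner (deriv_on I g t) (f t)"
  using deriv_on_hinner[OF assms(1-4)] deriv_on_const[OF assms(1,2,5)] hinner_commute[of "f t"]
  by simp

text \<open>Since \<open>s = g(\<nu>,\<nu>)\<close> satisfies \<open>s\<^sup>2 = 1\<close>, differentiation gives \<open>2 s s' = 0\<close> with \<open>s \<noteq> 0\<close>,
  hence \<open>0 = s' = 2 g(\<nu>', \<nu>)\<close>.\<close>

lemma hinner_deriv_on_self:
  assumes "\<forall>t\<in>I. t islimpt I" "t \<in> I" "smooth_on I \<nu>"
    and "\<And>t. t \<in> I \<Longrightarrow> hinner (\<nu> t) (\<nu> t) * hinner (\<nu> t) (\<nu> t) = 1"
  shows "hinner (deriv_on I \<nu> t) (\<nu> t) = 0"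
proof -
  define s where "s t = hinner (\<nu> t) (\<nu> t)" for t
  have lim: "t islimpt I" using assms(1,2) by blast
  have "smooth_on I s" unfolding s_def[abs_def] using assms by (intro hinner.smooth_on_bilinear)
  then have "(s has_vector_derivative deriv_on I s t) (at t within I)"
    using assms(2) by (intro has_vector_derivative_deriv_on smooth_on_differentiable_on)
  then have "deriv_on I (\<lambda>t. s t * s t) t = s t * deriv_on I s t + deriv_on I s t * s t"
    by (intro deriv_on_eqI[OF lim] has_vector_derivative_mult)
  moreover have "deriv_on I (\<lambda>t. s t * s t) t = 0"
    using assms(4) by (intro deriv_on_const[OF lim assms(2)]) (simp add: s_def)
  moreover have "s t \<noteq> 0" using assms(4)[OF assms(2)] by (auto simp: s_def)
  moreover have "deriv_on I s t = 2 * hinner (deriv_on I \<nu> t) (\<nu> t)"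
    using deriv_on_hinner[OF lim assms(2,3,3)] hinner_commute[of "\<nu> t"] by (simp add: s_def[abs_def])
  ultimately show ?thesis by simp
qed

text \<open>The coefficients in the expansion of \<open>\<nu>\<^sub>1'\<close> and \<open>\<gamma>'\<close> are curvatures by definition, and those of
  \<open>\<mu>'\<close> follow because the matrix of scalar products of frame vectors and their derivatives is skew.\<close>

lemma frenet_formulas:
  assumes perf: "\<forall>t\<in>I. t islimpt I" and fc: "framed_curve I \<gamma> \<nu>1 \<nu>2" and t: "t \<in> I"
  defines "\<mu> \<equiv> frame_mu \<nu>1 \<nu>2"
  defines "s1 \<equiv> sgn_at \<nu>1 t" and "s2 \<equiv> sgn_at \<nu>2 t"
  defines "l \<equiv> curv_l I \<nu>1 \<nu>2 t" and "m \<equiv> curv_m I \<nu>1 \<nu>2 t" and "n \<equiv> curv_n I \<nu>1 \<nu>2 t"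
  shows "deriv_on I \<gamma> t = curv_alpha I \<gamma> \<nu>1 \<nu>2 t *\<^sub>R \<mu> t" (is ?G)
    and "deriv_on I \<nu>1 t = l *\<^sub>R \<nu>2 t + m *\<^sub>R \<mu> t" (is ?N1)
    and "deriv_on I \<mu> t = - (s2 * m) *\<^sub>R \<nu>1 t - (s1 * n) *\<^sub>R \<nu>2 t" (is ?M)
proof -
  have sm: "smooth_on I \<nu>1" "smooth_on I \<nu>2" using fc by (auto simp: framed_curve_def)
  have smmu: "smooth_on I \<mu>" unfolding \<mu>_def using perf sm by (rule smooth_on_frame_mu)
  have lim: "t islimpt I" using perf t by blast
  note D = framed_curve_Delta[OF fc]
  have s: "s1 * s1 = 1" "s2 * s2 = 1"
    using Delta_sgn[OF D[OF t]] by (auto simp: s1_def s2_def sgn_at_def)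
  have ss: "s2 * (s1 * s2 * x) = s1 * x" "s1 * (s1 * s2 * x) = s2 * x" for x
    using s by algebra+
  note expand = frame_expansion[OF D[OF t], folded sgn_at_def frame_mu_def, folded \<mu>_def,
      folded s1_def s2_def]
  show ?G
    using expand[of "deriv_on I \<gamma> t"] fc t
    by (simp add: framed_curve_def curv_alpha_def \<mu>_def s1_def s2_def)
  show ?N1
    using expand[of "deriv_on I \<nu>1 t"] hinner_deriv_on_self[OF perf t sm(1)] Delta_sgn(1)[OF D]
    by (simp add: l_def m_def curv_l_def curv_m_def \<mu>_def s1_def s2_def)
  have "s1 * hinner (deriv_on I \<mu> t) (\<nu>1 t) = - (s2 * m)"
  proof -
    have "hinner (deriv_on I \<mu> t) (\<nu>1 t) = - hinner (deriv_on I \<nu>1 t) (\<mu> t)"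
      by (rule hinner_const_deriv_on[OF lim t smmu sm(1), where c = 0]) (simp add: \<mu>_def frame_mu_def)
    then show ?thesis
      using ss by (simp add: m_def curv_m_def flip: \<mu>_def s1_def s2_def)
  qed
  moreover have "s2 * hinner (deriv_on I \<mu> t) (\<nu>2 t) = - (s1 * n)"
  proof -
    have "hinner (deriv_on I \<mu> t) (\<nu>2 t) = - hinner (deriv_on I \<nu>2 t) (\<mu> t)"
      by (rule hinner_const_deriv_on[OF lim t smmu sm(2), where c = 0]) (simp add: \<mu>_def frame_mu_def)
    then show ?thesis
      using ss by (simp add: n_def curv_n_def flip: \<mu>_def s1_def s2_def)
  qed
  moreover have "hinner (deriv_on I \<mu> t) (\<mu> t) = 0"
  proof (rule hinner_deriv_on_self[OF perf t smmu])
    fix r assume "r \<in> I"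
    then show "hinner (\<mu> r) (\<mu> r) * hinner (\<mu> r) (\<mu> r) = 1"
      unfolding \<mu>_def frame_mu_def using Delta_sgn(2)[OF Delta_hcross[OF D]] by blast
  qed
  ultimately show ?M
    using expand[of "deriv_on I \<mu> t"] by simp
qed

text \<open>Replacing \<open>(\<nu>\<^sub>1, \<nu>\<^sub>2)\<close> by \<open>(\<nu>\<^sub>1, \<mu>)\<close> turns the third frame vector into \<open>\<nu>\<^sub>1 \<times> \<mu> = - s\<^sub>1 \<nu>\<^sub>2\<close>, so the
  curvature \<open>(l, m, n)\<close> becomes \<open>(m, - s\<^sub>1 l, n)\<close>.\<close>

lemma curvature_frame_swap:
  assumes perf: "\<forall>t\<in>I. t islimpt I" and fc: "framed_curve I \<gamma> \<nu>1 \<nu>2" and t: "t \<in> I"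
  defines "\<mu> \<equiv> frame_mu \<nu>1 \<nu>2"
  shows "sgn_at \<mu> t = sgn_at \<nu>1 t * sgn_at \<nu>2 t"
    and "frame_mu \<nu>1 \<mu> t = - sgn_at \<nu>1 t *\<^sub>R \<nu>2 t"
    and "curv_l I \<nu>1 \<mu> t = curv_m I \<nu>1 \<nu>2 t"
    and "curv_m I \<nu>1 \<mu> t = - sgn_at \<nu>1 t * curv_l I \<nu>1 \<nu>2 t"
    and "curv_n I \<nu>1 \<mu> t = curv_n I \<nu>1 \<nu>2 t"
proof -
  note D = framed_curve_Delta[OF fc t]
  define s1 s2 where "s1 = sgn_at \<nu>1 t" and "s2 = sgn_at \<nu>2 t"
  have s: "s1 * s1 = 1" "s2 * s2 = 1"
    using Delta_sgn[OF D] by (auto simp: s1_def s2_def sgn_at_def)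
  note F = frenet_formulas[OF perf fc t, folded \<mu>_def, folded s1_def s2_def]
  show smu: "sgn_at \<mu> t = sgn_at \<nu>1 t * sgn_at \<nu>2 t"
    unfolding sgn_at_def \<mu>_def frame_mu_def by (rule hinner_hcross_self[OF D])
  show mu: "frame_mu \<nu>1 \<mu> t = - sgn_at \<nu>1 t *\<^sub>R \<nu>2 t"
    unfolding sgn_at_def \<mu>_def frame_mu_def by (rule hcross_hcross_self[OF D])
  show "curv_l I \<nu>1 \<mu> t = curv_m I \<nu>1 \<nu>2 t"
    by (simp add: curv_l_def curv_m_def smu flip: \<mu>_def)
  have "curv_m I \<nu>1 \<mu> t = - (s1 * s1 * s1) * (s2 * hinner (deriv_on I \<nu>1 t) (\<nu>2 t))"
    by (simp add: curv_m_def smu mu hinner.minus_right hinner.scaleR_right s1_def s2_def)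
  then show "curv_m I \<nu>1 \<mu> t = - sgn_at \<nu>1 t * curv_l I \<nu>1 \<nu>2 t"
    using s by (simp add: curv_l_def s1_def s2_def)
  have "hinner (deriv_on I \<mu> t) (\<nu>2 t) = - (s1 * curv_n I \<nu>1 \<nu>2 t * s2)"
    using Delta_sgn(3)[OF D]
    by (simp add: F(3) hinner.diff_left hinner.minus_left hinner.scaleR_left s2_def sgn_at_def)
  then have "curv_n I \<nu>1 \<mu> t = (s1 * s1) * (s1 * s1) * (s2 * s2) * curv_n I \<nu>1 \<nu>2 t"
    by (simp add: curv_n_def[of I \<nu>1 \<mu>] smu mu hinner.minus_right hinner.scaleR_right
        s1_def[symmetric] s2_def[symmetric])
  then show "curv_n I \<nu>1 \<mu> t = curv_n I \<nu>1 \<nu>2 t" using s by simp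
qed

lemma smooth_on_sgn_at:
  assumes "\<forall>t\<in>I. t islimpt I" "smooth_on I \<nu>"
  shows "smooth_on I (sgn_at \<nu>)"
  unfolding sgn_at_def[abs_def] using assms by (intro hinner.smooth_on_bilinear)

lemmas smooth_on_mult = bounded_bilinear.smooth_on_bilinear[OF bounded_bilinear_mult]
lemmas smooth_on_scaleR = bounded_bilinear.smooth_on_bilinear[OF bounded_bilinear_scaleR]

lemma smooth_on_curv_m:
  assumes "\<forall>t\<in>I. t islimpt I" "smooth_on I \<nu>1" "smooth_on I \<nu>2"
  shows "smooth_on I (curv_m I \<nu>1 \<nu>2)"
  unfolding curv_m_def[abs_def] using assms
  by (intro smooth_on_mult smooth_on_sgn_at hinner.smooth_on_bilinear smooth_on_deriv_on
      smooth_on_frame_mu)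

lemma smooth_on_curv_alpha:
  assumes "\<forall>t\<in>I. t islimpt I" "smooth_on I \<gamma>" "smooth_on I \<nu>1" "smooth_on I \<nu>2"
  shows "smooth_on I (curv_alpha I \<gamma> \<nu>1 \<nu>2)"
  unfolding curv_alpha_def[abs_def] using assms
  by (intro smooth_on_mult smooth_on_sgn_at hinner.smooth_on_bilinear smooth_on_deriv_on
      smooth_on_frame_mu)

section \<open>The evolute of an involute\<close>

text \<open>If \<open>n = 0\<close> and \<open>\<alpha> = f m\<close>, then \<open>D = s\<^sub>1 s\<^sub>2 l m\<^sup>2\<close> and \<open>m \<alpha>' - m' \<alpha> = m\<^sup>2 f'\<close>, so the factor
  \<open>m\<^sup>2\<close> cancels in both coefficients of the evolute. Writing \<open>f' = s\<^sub>1 s\<^sub>2 l c\<close>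
  makes the second coefficient equal to \<open>c\<close>; for an involute \<open>c\<close> is \<open>f\<^sub>2\<close>.\<close>

lemma evolute_of_multiple:
  fixes f :: "real \<Rightarrow> real"
  assumes perf: "\<forall>t\<in>I. t islimpt I" and t: "t \<in> I"
    and sm: "smooth_on I \<nu>1" "smooth_on I \<nu>2"
    and n: "\<And>t. t \<in> I \<Longrightarrow> curv_n I \<nu>1 \<nu>2 t = 0"
    and \<alpha>: "\<And>t. t \<in> I \<Longrightarrow> curv_alpha I \<gamma> \<nu>1 \<nu>2 t = f t * curv_m I \<nu>1 \<nu>2 t"
    and f: "(f has_real_derivative sgn_at \<nu>1 t * sgn_at \<nu>2 t * curv_l I \<nu>1 \<nu>2 t * c) (at t within I)"
    and nz: "sgn_at \<nu>1 t \<noteq> 0" "sgn_at \<nu>2 t \<noteq> 0" "curv_l I \<nu>1 \<nu>2 t \<noteq> 0" "curv_m I \<nu>1 \<nu>2 t \<noteq> 0"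
  shows "evolute_denom I \<nu>1 \<nu>2 t \<noteq> 0"
    and "evolute I \<gamma> \<nu>1 \<nu>2 t = \<gamma> t - f t *\<^sub>R \<nu>1 t - c *\<^sub>R \<nu>2 t"
proof -
  have lim: "t islimpt I" using perf t by blast
  define p l m m' where "p = sgn_at \<nu>1 t * sgn_at \<nu>2 t" and "l = curv_l I \<nu>1 \<nu>2 t"
    and "m = curv_m I \<nu>1 \<nu>2 t" and "m' = deriv_on I (curv_m I \<nu>1 \<nu>2) t"
  have nz': "p \<noteq> 0" "l \<noteq> 0" "m \<noteq> 0" using nz by (auto simp: p_def l_def m_def)
  have n': "deriv_on I (curv_n I \<nu>1 \<nu>2) t = 0"
    using n by (rule deriv_on_const[OF lim t])
  have denom: "evolute_denom I \<nu>1 \<nu>2 t = p * l * m\<^sup>2"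
    using n[OF t] n' by (simp add: evolute_denom_def Let_def p_def l_def m_def)
  show "evolute_denom I \<nu>1 \<nu>2 t \<noteq> 0" using nz' by (simp add: denom)
  have "deriv_on I (curv_alpha I \<gamma> \<nu>1 \<nu>2) t = deriv_on I (\<lambda>t. f t * curv_m I \<nu>1 \<nu>2 t) t"
    using \<alpha> t by (rule deriv_on_cong)
  also have "\<dots> = f t * m' + (p * l * c) * m"
    unfolding m_def m'_def p_def l_def
    using f t perf sm
    by (intro deriv_on_eqI[OF lim] has_vector_derivative_mult has_vector_derivative_deriv_on
        smooth_on_differentiable_on smooth_on_curv_m)
       (simp_all add: has_real_derivative_iff_has_vector_derivative)
  finally have \<alpha>': "deriv_on I (curv_alpha I \<gamma> \<nu>1 \<nu>2) t = f t * m' + (p * l * c) * m" .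
  have "evolute I \<gamma> \<nu>1 \<nu>2 t = \<gamma> t - ((p * l * m * (f t * m)) / (p * l * m\<^sup>2)) *\<^sub>R \<nu>1 t
        - ((m * (f t * m' + (p * l * c) * m) - m' * (f t * m)) / (p * l * m\<^sup>2)) *\<^sub>R \<nu>2 t"
    using n[OF t] n' \<alpha>' \<alpha>[OF t]
    by (simp add: evolute_def Let_def denom p_def l_def m_def m'_def)
  also have "(p * l * m * (f t * m)) / (p * l * m\<^sup>2) = f t"
    using nz' by (simp add: field_simps power2_eq_square)
  also have "(m * (f t * m' + (p * l * c) * m) - m' * (f t * m)) / (p * l * m\<^sup>2) = c"
    using nz' by (simp add: field_simps power2_eq_square)
  finally show "evolute I \<gamma> \<nu>1 \<nu>2 t = \<gamma> t - f t *\<^sub>R \<nu>1 t - c *\<^sub>R \<nu>2 t" .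
qed

theorem theorem4p6:
  fixes I :: "real set"
    and \<gamma> n1 n2 \<iota> :: "real \<Rightarrow> hybrid"
    and L M \<alpha> :: "real \<Rightarrow> real"
  assumes "is_interval I" and "interior I \<noteq> {}"
    and "framed_curve I \<gamma> n1 n2"
    and "\<And>t. t \<in> I \<Longrightarrow> curvature I \<gamma> n1 n2 t = (L t, M t, 0, \<alpha> t)"
    and "\<And>t. t \<in> I \<Longrightarrow> M t > 0"
    and "\<And>t. t \<in> I \<Longrightarrow> L t \<noteq> 0"
    and "is_involute I \<gamma> n1 n2 \<iota>"
  shows "framed_curve I \<iota> n1 (frame_mu n1 n2) \<and>
         (\<forall>t\<in>I. evolute_denom I n1 (frame_mu n1 n2) t \<noteq> 0) \<and>
         (\<forall>t\<in>I. evolute I \<iota> n1 (frame_mu n1 n2) t = \<gamma> t)"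
proof -
  define \<mu> where "\<mu> = frame_mu n1 n2"
  have perf: "\<forall>t\<in>I. t islimpt I" using interval_islimpt[OF assms(1,2)] by blast
  have curv: "curv_l I n1 n2 t = L t" "curv_m I n1 n2 t = M t" "curv_n I n1 n2 t = 0"
    "curv_alpha I \<gamma> n1 n2 t = \<alpha> t" if "t \<in> I" for t
    using assms(4)[OF that] by (auto simp: curvature_def)
  obtain f1 f2 :: "real \<Rightarrow> real" where
    f1: "\<And>t. t \<in> I \<Longrightarrow> (f1 has_real_derivative sgn_at n1 t * sgn_at \<mu> t * curv_m I n1 n2 t * f2 t) (at t within I)"
    and f2: "\<And>t. t \<in> I \<Longrightarrow>
      (f2 has_real_derivative - curv_m I n1 n2 t * f1 t - curv_alpha I \<gamma> n1 n2 t) (at t within I)"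
    and \<iota>: "\<And>t. t \<in> I \<Longrightarrow> \<iota> t = \<gamma> t + f1 t *\<^sub>R n1 t + f2 t *\<^sub>R \<mu> t"
    using assms(7) unfolding is_involute_def Let_def \<mu>_def[symmetric] by blast
  have sm: "smooth_on I \<gamma>" "smooth_on I n1" "smooth_on I n2"
    using assms(3) by (auto simp: framed_curve_def)
  have smmu: "smooth_on I \<mu>" unfolding \<mu>_def using perf sm(2,3) by (rule smooth_on_frame_mu)
  note D = framed_curve_Delta[OF assms(3)]
  note swap = curvature_frame_swap[OF perf assms(3), folded \<mu>_def]
  note F = frenet_formulas[OF perf assms(3), folded \<mu>_def]
  have s: "sgn_at n1 t * sgn_at n1 t = 1" "sgn_at n2 t * sgn_at n2 t = 1" if "t \<in> I" for t
    using Delta_sgn[OF D[OF that]] by (auto simp: sgn_at_def)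

  have smf: "smooth_on I f1" "smooth_on I f2"
  proof -
    let ?a = "\<lambda>t. sgn_at n1 t * sgn_at \<mu> t * curv_m I n1 n2 t"
    let ?b = "\<lambda>t. - 1 * curv_m I n1 n2 t" and ?c = "\<lambda>t. - 1 * curv_alpha I \<gamma> n1 n2 t"
    have a: "smooth_on I ?a" and b: "smooth_on I ?b" and c: "smooth_on I ?c"
      by (intro smooth_on_mult smooth_on_const smooth_on_sgn_at smooth_on_curv_m
          smooth_on_curv_alpha perf sm smmu)+
    have "(f2 has_real_derivative ?b t * f1 t + ?c t) (at t within I)" if "t \<in> I" for t
      using f2[OF that] by simp
    from smooth_on_linear_system[OF perf f1 this a b c]
    show "smooth_on I f1" "smooth_on I f2" by auto
  qed
  have smi: "smooth_on I \<iota>"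
    using smooth_on_cong[of I \<iota> "\<lambda>t. \<gamma> t + f1 t *\<^sub>R n1 t + f2 t *\<^sub>R \<mu> t"] \<iota> perf sm smmu smf
    by (simp add: smooth_on_add smooth_on_scaleR)

  \<comment> \<open>The equations for \<open>f1\<close> and \<open>f2\<close> cancel the components along \<open>n1\<close> and \<open>\<mu>\<close>; what is left
    comes from the \<open>n2\<close>-component of \<open>n1'\<close>.\<close>
  have di: "deriv_on I \<iota> t = (f1 t * L t) *\<^sub>R n2 t" if t: "t \<in> I" for t
  proof -
    let ?M = "curv_m I n1 n2 t" and ?f1' = "sgn_at n1 t * sgn_at \<mu> t * curv_m I n1 n2 t * f2 t"
      and ?f2' = "- curv_m I n1 n2 t * f1 t - curv_alpha I \<gamma> n1 n2 t"
    note hvd = has_vector_derivative_deriv_on[OF smooth_on_differentiable_on t]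
    have "deriv_on I \<iota> t = deriv_on I (\<lambda>t. \<gamma> t + f1 t *\<^sub>R n1 t + f2 t *\<^sub>R \<mu> t) t"
      using \<iota> t by (rule deriv_on_cong)
    also have "\<dots> = deriv_on I \<gamma> t + (f1 t *\<^sub>R deriv_on I n1 t + ?f1' *\<^sub>R n1 t)
        + (f2 t *\<^sub>R deriv_on I \<mu> t + ?f2' *\<^sub>R \<mu> t)"
      using perf t sm smmu f1[OF t] f2[OF t]
      by (intro deriv_on_eqI has_vector_derivative_add has_vector_derivative_scaleR hvd) auto
    also have "?f1' = sgn_at n2 t * ?M * f2 t"
      using s[OF t] by (simp add: swap(1)[OF t])
    finally show ?thesis
      using F[OF t] curv[OF t] by (simp add: algebra_simps)
  qed
  have fc: "framed_curve I \<iota> n1 \<mu>"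
    unfolding framed_curve_def
  proof (intro conjI ballI)
    fix t assume t: "t \<in> I"
    show "(n1 t, \<mu> t) \<in> Delta" unfolding \<mu>_def frame_mu_def by (rule Delta_hcross[OF D[OF t]])
    show "hinner (deriv_on I \<iota> t) (n1 t) = 0"
      using Delta_sgn(3)[OF D[OF t]] hinner_commute[of "n2 t" "n1 t"]
      by (simp add: di[OF t] hinner.scaleR_left)
    show "hinner (deriv_on I \<iota> t) (\<mu> t) = 0"
      by (simp add: di[OF t] hinner.scaleR_left \<mu>_def frame_mu_def)
  qed (use sm smmu smi in auto)

  have ev: "evolute_denom I n1 \<mu> t \<noteq> 0 \<and> evolute I \<iota> n1 \<mu> t = \<iota> t - f1 t *\<^sub>R n1 t - f2 t *\<^sub>R \<mu> t"
    if t: "t \<in> I" for t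
  proof -
    have n: "curv_n I n1 \<mu> r = 0" if "r \<in> I" for r
      using swap(5)[OF that] curv(3)[OF that] by simp
    have al: "curv_alpha I \<iota> n1 \<mu> r = f1 r * curv_m I n1 \<mu> r" if r: "r \<in> I" for r
    proof -
      have "curv_alpha I \<iota> n1 \<mu> r = - (sgn_at n1 r * sgn_at n1 r) * (sgn_at n2 r * sgn_at n2 r) * (sgn_at n1 r * f1 r * L r)"
        unfolding curv_alpha_def swap(1,2)[OF r] di[OF r]
        by (simp add: hinner.scaleR_left hinner.scaleR_right hinner.minus_right sgn_at_def)
      then show ?thesis using s[OF r] by (simp add: swap(4)[OF r] curv(1)[OF r])
    qed
    have d: "(f1 has_real_derivative sgn_at n1 t * sgn_at \<mu> t * curv_l I n1 \<mu> t * f2 t) (at t within I)"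
      using f1[OF t] by (simp add: swap(3)[OF t])
    have nz: "sgn_at n1 t \<noteq> 0" "sgn_at \<mu> t \<noteq> 0" using s[OF t] by (auto simp: swap(1)[OF t])
    have l: "curv_l I n1 \<mu> t \<noteq> 0" using assms(5)[OF t] by (simp add: swap(3)[OF t] curv(2)[OF t])
    have m: "curv_m I n1 \<mu> t \<noteq> 0"
      using assms(6)[OF t] nz(1) by (simp add: swap(4)[OF t] curv(1)[OF t])
    show ?thesis
      using evolute_of_multiple[OF perf t sm(2) smmu n al d nz l m] by blast
  qed
  show ?thesis
    using fc ev \<iota> unfolding \<mu>_def by auto
qed

end
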